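(* Let $\gamma=(x,y)$ be a smooth curve in the affine plane with strictly positive equi-affine curvature. Then $\gamma$ is a critical point of the full-affine arc-length $\int\sqrt{\kappa}\,\mathrm{d}s$ (among strictly positively curved curves, with respect to compactly supported variations) if and only if either $\gamma$ is a full-affine W-curve (its full-affine curvature $\kappa_{\mathbf F}$ is constant), or, for a suitable choice of origin of the coordinates $(x,y)$, the full-affine curvature is a non-zero linear function of the position vector: $\kappa_{\mathbf F}=A\,x+B\,y$ with $(A,B)\neq(0,0)$.
   Context: The affine plane is $\mathbb{R}^2$ with area form $|u,v|=\det(u,v)$. The curve is parametrised by equi-affine arc-length $s$, i.e. $|\gamma',\gamma''|=1$; primes denote $s$-derivatives; the equi-affine curvature $\kappa$ is defined by $\gamma'''=-\kappa\gamma'$, and strictly positively curved means $\kappa>0$. The full-affine arc-length element is $\mathrm{d}s_{\mathbf F}=\sqrt{\kappa}\,\mathrm{d}s$ and the full-affine curvature is $\kappa_{\mathbf F}=\dfrac{\kappa'}{2\kappa^{3/2}}$. A full-affine W-curve is a curve with constant full-affine curvature. Critical point means the first variation of the functional vanishes for all smooth compactly supported variations. *)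

theory Defs
  imports "HOL-Analysis.Analysis"
begin

text \<open>Plane curves are given by their two coordinate functions u, v :: real => real
  (points (u t, v t) of the affine plane R^2, area form det).\<close>

definition smooth_on :: "real set \<Rightarrow> (real \<Rightarrow> real) \<Rightarrow> bool" where
  "smooth_on S f \<longleftrightarrow> (\<forall>n. \<forall>t\<in>S. ((deriv ^^ n) f) differentiable (at t))"

text \<open>Equi-affine arc-length element ds/dt = |c_t, c_tt|^(1/3) of a curve c = (u,v)
  in an arbitrary parametrisation t.\<close>
definition aff_speed :: "(real \<Rightarrow> real) \<Rightarrow> (real \<Rightarrow> real) \<Rightarrow> real \<Rightarrow> real" where
  "aff_speed u v t = root 3 (deriv u t * (deriv ^^ 2) v t - deriv v t * (deriv ^^ 2) u t)"

text \<open>Derivative with respect to equi-affine arc-length: d/ds = (ds/dt)^(-1) d/dt.\<close>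
definition sD :: "(real \<Rightarrow> real) \<Rightarrow> (real \<Rightarrow> real) \<Rightarrow> (real \<Rightarrow> real) \<Rightarrow> real \<Rightarrow> real" where
  "sD u v f = (\<lambda>t. deriv f t / aff_speed u v t)"

text \<open>Equi-affine curvature in an arbitrary parametrisation: kappa = |c'', c'''| with
  primes = d/ds; for an equi-affine arc-length parametrisation (gamma''' = - kappa gamma',
  |gamma',gamma''| = 1) this is exactly kappa.\<close>
definition eq_aff_curv :: "(real \<Rightarrow> real) \<Rightarrow> (real \<Rightarrow> real) \<Rightarrow> real \<Rightarrow> real" where
  "eq_aff_curv u v t =
     (let D = sD u v in D (D u) t * D (D (D v)) t - D (D v) t * D (D (D u)) t)"

definition full_aff_lagr :: "(real \<Rightarrow> real) \<Rightarrow> (real \<Rightarrow> real) \<Rightarrow> real \<Rightarrow> real" where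
  "full_aff_lagr u v t = sqrt (eq_aff_curv u v t) * aff_speed u v t"

definition full_aff_length :: "(real \<Rightarrow> real) \<Rightarrow> (real \<Rightarrow> real) \<Rightarrow> real \<Rightarrow> real \<Rightarrow> real" where
  "full_aff_length u v a b = integral {a..b} (full_aff_lagr u v)"

definition critical_full_affine :: "real set \<Rightarrow> (real \<Rightarrow> real) \<Rightarrow> (real \<Rightarrow> real) \<Rightarrow> bool" where
  "critical_full_affine I x y \<longleftrightarrow>
     (\<forall>Wx Wy a b. smooth_on I Wx \<longrightarrow> smooth_on I Wy \<longrightarrow> {a..b} \<subseteq> I \<longrightarrow>
        (\<forall>t\<in>I - {a..b}. Wx t = 0 \<and> Wy t = 0) \<longrightarrow>
        ((\<lambda>\<epsilon>. full_aff_length (\<lambda>t. x t + \<epsilon> * Wx t) (\<lambda>t. y t + \<epsilon> * Wy t) a b)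
           has_real_derivative 0) (at 0))"

text \<open>Full-affine curvature kappa_F = kappa' / (2 kappa^(3/2)) (arc-length parametrisation).\<close>
definition full_aff_curv :: "(real \<Rightarrow> real) \<Rightarrow> real \<Rightarrow> real" where
  "full_aff_curv k t = deriv k t / (2 * k t powr (3/2))"

end

theory Submission
  imports Defs
begin

text \<open>
  With \<open>\<mu> = \<kappa>\<^bsup>-1/2\<^esup> / 2\<close> we have \<open>\<kappa>\<^sub>F = - 2 \<mu>'\<close>. In an arbitrary parametrisation the
  squared Lagrangian is a rational function of the wedge products of the derivatives of the curve,
  and integrating its variation by parts at an arc-length parametrised curve gives the first
  variation \<open>1/3 \<integral> (\<mu>'''' + \<kappa> \<mu>'') |\<gamma>',W|\<close> in direction \<open>W\<close>. Criticality is therefore the equation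
  \<open>\<kappa>\<^sub>F''' = - \<kappa> \<kappa>\<^sub>F'\<close>, which is also the equation satisfied by the coordinates of \<open>\<gamma>\<close>; hence its
  solutions are the affine functions of the position vector.
\<close>

section \<open>Smooth functions on open sets\<close>

lemma smooth_on_has_derivative:
  assumes "smooth_on S f" "t \<in> S"
  shows "((deriv ^^ n) f has_real_derivative (deriv ^^ Suc n) f t) (at t)"
  using assms by (auto simp: smooth_on_def intro: DERIV_deriv_iff_real_differentiable[THEN iffD2])

lemma smooth_on_funpow_deriv: "smooth_on S f \<Longrightarrow> smooth_on S ((deriv ^^ n) f)"
  by (metis comp_apply funpow_add smooth_on_def)

lemma smooth_on_continuous: "smooth_on S f \<Longrightarrow> continuous_on S ((deriv ^^ n) f)"
  by (meson DERIV_isCont continuous_at_imp_continuous_on smooth_on_has_derivative)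

text \<open>Identifies iterated derivatives from a guessed sequence. Openness is essential: to
  differentiate the induction hypothesis at \<open>t\<close>, it must hold on a neighbourhood of
  \<open>t\<close>.\<close>

lemma funpow_deriv_eq_on_open:
  assumes "open S" "F 0 = f"
    and F: "\<And>n t. t \<in> S \<Longrightarrow> (F n has_real_derivative F (Suc n) t) (at t)"
    and "t \<in> S"
  shows "(deriv ^^ n) f t = F n t"
  using \<open>t \<in> S\<close>
proof (induction n arbitrary: t)
  case 0
  then show ?case using \<open>F 0 = f\<close> by simp
next
  case (Suc n)
  have "((deriv ^^ n) f has_real_derivative F (Suc n) t) (at t)"
    by (rule has_field_derivative_transform_within_open[OF F \<open>open S\<close>]) (use Suc in auto)
  then show ?case by (simp add: DERIV_imp_deriv)
qed

text \<open>Choosing for each member of \<open>P\<close> a derivative again in \<open>P\<close> and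
  iterating this choice from \<open>f\<close> produces a full sequence of derivatives, which must
  agree with \<open>deriv ^^ n\<close> on the open set.\<close>

lemma smooth_on_coinduct:
  assumes "open S" "P f"
    and step: "\<And>g. P g \<Longrightarrow> \<exists>g'. P g' \<and> (\<forall>t\<in>S. (g has_real_derivative g' t) (at t))"
  shows "smooth_on S f"
proof -
  obtain d where d: "\<And>g. P g \<Longrightarrow> P (d g)"
      "\<And>g t. P g \<Longrightarrow> t \<in> S \<Longrightarrow> (g has_real_derivative d g t) (at t)"
    using step by metis
  define F where "F n = (d ^^ n) f" for n
  have P: "P (F n)" for n
    unfolding F_def by (induction n) (use assms d in auto)
  have F: "(F n has_real_derivative F (Suc n) t) (at t)" if "t \<in> S" for n t
    using d(2)[OF P that] by (simp add: F_def)
  have eq: "(deriv ^^ n) f t = F n t" if "t \<in> S" for n t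
    by (rule funpow_deriv_eq_on_open[where F = F]) (use assms F that in \<open>auto simp: F_def\<close>)
  show ?thesis
    unfolding smooth_on_def
  proof (intro allI ballI)
    fix n t assume "t \<in> S"
    have "((deriv ^^ n) f has_real_derivative F (Suc n) t) (at t)"
      by (rule has_field_derivative_transform_within_open[OF F \<open>open S\<close>])
        (use \<open>t \<in> S\<close> eq in auto)
    then show "(deriv ^^ n) f differentiable at t"
      using real_differentiable_def by blast
  qed
qed

text \<open>Closing the smooth functions under the algebraic operations yields a class that is closed
  under differentiation, so its members are smooth by coinduction; this avoids Leibniz formulas
  for higher derivatives.\<close>

inductive smooth_closure :: "real set \<Rightarrow> (real \<Rightarrow> real) \<Rightarrow> bool" for S where
  base: "smooth_on S f \<Longrightarrow> smooth_closure S f"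
| const: "smooth_closure S (\<lambda>t. c)"
| add: "smooth_closure S f \<Longrightarrow> smooth_closure S g \<Longrightarrow> smooth_closure S (\<lambda>t. f t + g t)"
| mult: "smooth_closure S f \<Longrightarrow> smooth_closure S g \<Longrightarrow> smooth_closure S (\<lambda>t. f t * g t)"
| powr: "smooth_closure S f \<Longrightarrow> \<forall>t\<in>S. f t > 0 \<Longrightarrow> smooth_closure S (\<lambda>t. f t powr a)"

lemma smooth_closure_derivative:
  assumes "smooth_closure S f"
  shows "\<exists>f'. smooth_closure S f' \<and> (\<forall>t\<in>S. (f has_real_derivative f' t) (at t))"
  using assms
proof induction
  case (base f)
  then show ?case
    using smooth_on_has_derivative[of S f _ 0] smooth_on_funpow_deriv[of S f 1]
    by (intro exI[of _ "deriv f"]) (auto intro: smooth_closure.base)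
next
  case (const c)
  then show ?case
    by (intro exI[of _ "\<lambda>t. 0"]) (auto intro: smooth_closure.const)
next
  case (add f g)
  then obtain f' g' where "smooth_closure S f'" "smooth_closure S g'"
    "\<forall>t\<in>S. (f has_real_derivative f' t) (at t)" "\<forall>t\<in>S. (g has_real_derivative g' t) (at t)"
    by blast
  then show ?case
    by (intro exI[of _ "\<lambda>t. f' t + g' t"]) (auto intro: smooth_closure.add DERIV_add)
next
  case (mult f g)
  then obtain f' g' where "smooth_closure S f'" "smooth_closure S g'"
    "\<forall>t\<in>S. (f has_real_derivative f' t) (at t)" "\<forall>t\<in>S. (g has_real_derivative g' t) (at t)"
    by blast
  with mult show ?case
    by (intro exI[of _ "\<lambda>t. f' t * g t + g' t * f t"])
      (auto intro: smooth_closure.intros DERIV_mult)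
next
  case (powr f a)
  then obtain f' where f': "smooth_closure S f'" "\<forall>t\<in>S. (f has_real_derivative f' t) (at t)"
    by blast
  have "((\<lambda>t. f t powr a) has_real_derivative a * f t powr (a - 1) * f' t) (at t)" if "t \<in> S" for t
    using DERIV_fun_powr[of f "f' t" t a] f' powr that by simp
  moreover have "smooth_closure S (\<lambda>t. a * f t powr (a - 1) * f' t)"
    by (intro smooth_closure.mult smooth_closure.const smooth_closure.powr f' powr)
  ultimately show ?case by blast
qed

lemma smooth_closure_imp_smooth_on: "open S \<Longrightarrow> smooth_closure S f \<Longrightarrow> smooth_on S f"
  by (rule smooth_on_coinduct[where P = "smooth_closure S"]) (auto dest: smooth_closure_derivative)

lemma smooth_on_add: "open S \<Longrightarrow> smooth_on S f \<Longrightarrow> smooth_on S g \<Longrightarrow> smooth_on S (\<lambda>t. f t + g t)"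
  and smooth_on_mult: "open S \<Longrightarrow> smooth_on S f \<Longrightarrow> smooth_on S g \<Longrightarrow> smooth_on S (\<lambda>t. f t * g t)"
  and smooth_on_const: "open S \<Longrightarrow> smooth_on S (\<lambda>t. c)"
  and smooth_on_powr: "open S \<Longrightarrow> smooth_on S f \<Longrightarrow> \<forall>t\<in>S. f t > 0 \<Longrightarrow> smooth_on S (\<lambda>t. f t powr a)"
  by (rule smooth_closure_imp_smooth_on, assumption,
      rule smooth_closure.add smooth_closure.mult smooth_closure.const smooth_closure.powr;
      (assumption | rule smooth_closure.base)+)+

lemma smooth_on_diff: "open S \<Longrightarrow> smooth_on S f \<Longrightarrow> smooth_on S g \<Longrightarrow> smooth_on S (\<lambda>t. f t - g t)"
  using smooth_on_add[of S f "\<lambda>t. -1 * g t"] smooth_on_mult[of S "\<lambda>t. -1" g] smooth_on_const[of S "-1"]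
  by simp

lemma smooth_on_subset: "smooth_on S f \<Longrightarrow> T \<subseteq> S \<Longrightarrow> smooth_on T f"
  by (auto simp: smooth_on_def)

lemma funpow_deriv_cong_on_open:
  assumes "open S" "\<forall>t\<in>S. f t = g t" "t \<in> S"
  shows "(deriv ^^ n) f t = (deriv ^^ n) g t"
  using \<open>t \<in> S\<close>
proof (induction n arbitrary: t)
  case (Suc n)
  have "\<forall>\<^sub>F s in nhds t. (deriv ^^ n) f s = (deriv ^^ n) g s"
    by (rule eventually_mono[OF eventually_nhds_in_open[OF \<open>open S\<close> \<open>t \<in> S\<close>]]) (rule Suc.IH)
  then show ?case by (simp add: deriv_cong_ev)
qed (use assms in simp)

lemma smooth_on_cong:
  assumes "open S" "\<forall>t\<in>S. f t = g t" "smooth_on S f"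
  shows "smooth_on S g"
proof -
  have "((deriv ^^ n) g has_real_derivative (deriv ^^ Suc n) f t) (at t)" if "t \<in> S" for n t
    by (rule has_field_derivative_transform_within_open
          [OF smooth_on_has_derivative[OF assms(3) that] \<open>open S\<close> that])
      (use funpow_deriv_cong_on_open[OF assms(1,2)] in auto)
  then show ?thesis
    unfolding smooth_on_def using real_differentiable_def by blast
qed

lemma funpow_deriv_add_scaled:
  assumes "open S" "smooth_on S f" "smooth_on S g" "t \<in> S"
  shows "(deriv ^^ n) (\<lambda>t. f t + e * g t) t = (deriv ^^ n) f t + e * (deriv ^^ n) g t"
proof (rule funpow_deriv_eq_on_open[where F = "\<lambda>n t. (deriv ^^ n) f t + e * (deriv ^^ n) g t"])
  show "((\<lambda>t. (deriv ^^ n) f t + e * (deriv ^^ n) g t) has_real_derivative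
      (deriv ^^ Suc n) f t + e * (deriv ^^ Suc n) g t) (at t)" if "t \<in> S" for n t
    using smooth_on_has_derivative[OF assms(2) that, of n]
      smooth_on_has_derivative[OF assms(3) that, of n]
    by (auto intro!: DERIV_add DERIV_cmult)
qed (use assms in auto)

section \<open>Flat functions and smooth bumps\<close>

text \<open>The family of all \<open>p (1/t) exp (-1/t)\<close>, extended by zero to the left half-line, is closed
  under differentiation.\<close>

definition flat_exp :: "real poly \<Rightarrow> real \<Rightarrow> real" where
  "flat_exp p t = (if t > 0 then poly p (1 / t) * exp (- (1 / t)) else 0)"

text \<open>This is the difference quotient at 0. On the right, substituting
  \<open>s = 1 / h\<close> turns it into \<open>s * poly p s * exp (- s)\<close>, which the
  exponential sends to 0; \<open>pCons 0 p\<close> supplies the extra factor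
  \<open>s\<close>.\<close>

lemma flat_exp_tendsto_0: "((\<lambda>h. flat_exp p h / h) \<longlongrightarrow> 0) (at 0)"
proof -
  have lim: "((\<lambda>s. poly q s * exp (- s)) \<longlongrightarrow> 0) at_top" for q :: "real poly"
  proof -
    have *: "((\<lambda>s. coeff q i * (s ^ i / exp s)) \<longlongrightarrow> coeff q i * 0) at_top" for i
      by (intro tendsto_intros tendsto_power_div_exp_0)
    have "((\<lambda>s. \<Sum>i\<le>degree q. coeff q i * (s ^ i / exp s)) \<longlongrightarrow> (\<Sum>i\<le>degree q. coeff q i * 0)) at_top"
      by (rule tendsto_sum) (use * in auto)
    then show ?thesis
      by (simp add: poly_altdef sum_divide_distrib exp_minus divide_inverse[symmetric])
  qed
  have "((\<lambda>h. poly (pCons 0 p) (inverse h) * exp (- inverse h)) \<longlongrightarrow> 0) (at_right 0)"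
    by (rule filterlim_compose[OF lim filterlim_inverse_at_top_right])
  then have "((\<lambda>h. flat_exp p h / h) \<longlongrightarrow> 0) (at_right 0)"
    by (rule Lim_transform_eventually)
      (auto simp: eventually_at_filter flat_exp_def field_simps)
  moreover have "((\<lambda>h. flat_exp p h / h) \<longlongrightarrow> 0) (at_left 0)"
    by (rule Lim_transform_eventually[OF tendsto_const])
      (auto simp: eventually_at_filter flat_exp_def)
  ultimately show ?thesis
    by (simp add: filterlim_at_split)
qed

text \<open>For positive \<open>t\<close> the inner derivative \<open>- 1 / t^2\<close> hits both
  factors, giving \<open>(p - pderiv p)\<close> at \<open>1 / t\<close> times
  \<open>1 / t^2\<close>; \<open>[:0, 0, 1:]\<close> is the square of the indeterminate. At 0 both
  one-sided difference quotients tend to 0.\<close>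

lemma flat_exp_derivative:
  "(flat_exp p has_real_derivative flat_exp ([:0, 0, 1:] * (p - pderiv p)) t) (at t)"
proof -
  consider "t > 0" | "t < 0" | "t = 0" by linarith
  then show ?thesis
  proof cases
    case 1
    have "((\<lambda>t. poly p (1 / t) * exp (- (1 / t))) has_real_derivative
        flat_exp ([:0, 0, 1:] * (p - pderiv p)) t) (at t)"
      using 1 by (auto intro!: derivative_eq_intros DERIV_chain2[OF poly_DERIV]
          simp: flat_exp_def field_simps power2_eq_square)
    then show ?thesis
      by (rule has_field_derivative_transform_within_open[where S = "{0<..}"])
        (use 1 in \<open>auto simp: flat_exp_def\<close>)
  next
    case 2
    have "((\<lambda>t. 0) has_real_derivative flat_exp ([:0, 0, 1:] * (p - pderiv p)) t) (at t)"
      using 2 by (simp add: flat_exp_def)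
    then show ?thesis
      by (rule has_field_derivative_transform_within_open[where S = "{..<0}"])
        (use 2 in \<open>auto simp: flat_exp_def\<close>)
  next
    case 3
    then show ?thesis
      using flat_exp_tendsto_0[of p] by (simp add: DERIV_def) (simp add: flat_exp_def)
  qed
qed

text \<open>The scalar \<open>r\<close> in the coinduction predicate absorbs the factor
  \<open>m\<close> that the chain rule contributes at every differentiation.\<close>

lemma flat_exp_affine_smooth: "smooth_on UNIV (\<lambda>t. flat_exp p (m * t + c))"
proof (rule smooth_on_coinduct[where P = "\<lambda>f. \<exists>p r. f = (\<lambda>t. r * flat_exp p (m * t + c))"])
  show "\<exists>q r. (\<lambda>t. flat_exp p (m * t + c)) = (\<lambda>t. r * flat_exp q (m * t + c))"
    by (intro exI[of _ p] exI[of _ 1]) simp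
next
  fix g assume "\<exists>p r. g = (\<lambda>t. r * flat_exp p (m * t + c))"
  then obtain p r where g: "g = (\<lambda>t. r * flat_exp p (m * t + c))" by blast
  let ?q = "[:0, 0, 1:] * (p - pderiv p)"
  have "(g has_real_derivative (r * m) * flat_exp ?q (m * t + c)) (at t)" for t
    unfolding g
    by (rule derivative_eq_intros DERIV_chain2[OF flat_exp_derivative] refl | simp)+
  then show "\<exists>g'. (\<exists>p r. g' = (\<lambda>t. r * flat_exp p (m * t + c))) \<and>
      (\<forall>t\<in>UNIV. (g has_real_derivative g' t) (at t))"
    by blast
qed simp

text \<open>A product of two flat functions, one vanishing up to \<open>a\<close> and the other,
  reflected, from \<open>b\<close> on.\<close>

lemma smooth_bump_exists:
  fixes a b :: real
  obtains \<phi> where "smooth_on UNIV \<phi>" "\<And>t. t \<in> {a<..<b} \<Longrightarrow> \<phi> t > 0" "\<And>t. t \<notin> {a<..<b} \<Longrightarrow> \<phi> t = 0"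
proof
  let ?\<phi> = "\<lambda>t. flat_exp 1 (1 * t + (- a)) * flat_exp 1 (-1 * t + b)"
  show "smooth_on UNIV ?\<phi>"
    by (intro smooth_on_mult flat_exp_affine_smooth) simp
qed (auto simp: flat_exp_def)

section \<open>The Lagrangian in an arbitrary parametrisation\<close>

definition wedge :: "(real \<Rightarrow> real) \<Rightarrow> (real \<Rightarrow> real) \<Rightarrow> nat \<Rightarrow> nat \<Rightarrow> real \<Rightarrow> real" where
  "wedge u v i j t = (deriv ^^ i) u t * (deriv ^^ j) v t - (deriv ^^ i) v t * (deriv ^^ j) u t"

lemma wedge_has_derivative:
  assumes "smooth_on S u" "smooth_on S v" "t \<in> S"
  shows "(wedge u v i j has_real_derivative wedge u v (Suc i) j t + wedge u v i (Suc j) t) (at t)"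
proof -
  have *: "wedge u v i j = (\<lambda>t. (deriv ^^ i) u t * (deriv ^^ j) v t - (deriv ^^ i) v t * (deriv ^^ j) u t)"
    by (auto simp: wedge_def)
  show ?thesis
    unfolding *
    by (rule derivative_eq_intros smooth_on_has_derivative[OF assms(1,3)]
          smooth_on_has_derivative[OF assms(2,3)] refl)+ (simp add: wedge_def algebra_simps)
qed

text \<open>The square of the full-affine arc-length element, \<open>\<kappa> |c\<^sub>t,c\<^sub>t\<^sub>t|\<^bsup>2/3\<^esup>\<close>.\<close>

definition wedge_lagr :: "real \<Rightarrow> real \<Rightarrow> real \<Rightarrow> real \<Rightarrow> real" where
  "wedge_lagr w12 w13 w14 w23 = (4 * w23 + w14) / (3 * w12) - 5 / 9 * (w13 / w12)\<^sup>2"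

text \<open>Expanding the bracket of the second and third \<open>s\<close>-derivatives with
  \<open>d/ds = q d/dt\<close> leaves only integer powers of brackets under a single square root, a
  form that is easy to differentiate along a variation.\<close>

lemma full_aff_lagr_eq:
  assumes "open S" and u: "smooth_on S u" and v: "smooth_on S v"
    and pos: "\<forall>t\<in>S. wedge u v 1 2 t > 0" and "t \<in> S"
  shows "full_aff_lagr u v t =
    sqrt (wedge_lagr (wedge u v 1 2 t) (wedge u v 1 3 t) (wedge u v 1 4 t) (wedge u v 2 3 t))"
proof -
  \<comment> \<open>\<open>q\<close> is dt/ds, the reciprocal of the affine speed; \<open>q1\<close>
    and \<open>q2\<close> are its first two derivatives, kept polynomial in \<open>q\<close> and the
    brackets through \<open>q ^ 4 = wedge u v 1 2 powr (- 4 / 3)\<close>.\<close>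
  define q where "q s = wedge u v 1 2 s powr (- 1 / 3)" for s
  define q1 where "q1 s = - (1 / 3) * wedge u v 1 3 s * q s ^ 4" for s
  define q2 where "q2 s = - (1 / 3) *
    ((wedge u v 2 3 s + wedge u v 1 4 s) * q s ^ 4 + wedge u v 1 3 s * (4 * q s ^ 3 * q1 s))" for s
  have q_pos: "q s > 0" if "s \<in> S" for s
    using bspec[OF pos that] unfolding q_def by simp
  have speed: "aff_speed u v s = 1 / q s" if "s \<in> S" for s
  proof -
    have "aff_speed u v s = wedge u v 1 2 s powr (1 / 3)"
      using bspec[OF pos that] unfolding aff_speed_def
      by (subst root_powr_inverse) (simp_all add: wedge_def)
    then show ?thesis
      using powr_minus_divide[of "wedge u v 1 2 s" "1 / 3"] by (simp add: q_def)
  qed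
  have q_power: "q s ^ n = wedge u v 1 2 s powr (- 1 / 3 * real n)" if "s \<in> S" for s n
    using bspec[OF pos that] unfolding q_def by (subst powr_power) simp_all
  have w12: "wedge u v 1 2 s = 1 / q s ^ 3" if "s \<in> S" for s
    using bspec[OF pos that] unfolding q_power[OF that] by (simp add: powr_minus_divide)
  \<comment> \<open>The product rule also yields the bracket with indices 2 and 2, which vanishes by
    antisymmetry.\<close>
  have dw: "(wedge u v 1 2 has_real_derivative wedge u v 1 3 s) (at s)"
      "(wedge u v 1 3 has_real_derivative wedge u v 2 3 s + wedge u v 1 4 s) (at s)" if "s \<in> S" for s
    using wedge_has_derivative[OF u v that, of 1 2] wedge_has_derivative[OF u v that, of 1 3]
    by (simp_all add: numeral_eq_Suc) (simp add: wedge_def)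
  have dq: "(q has_real_derivative q1 s) (at s)" if "s \<in> S" for s
  proof -
    have "((\<lambda>s. wedge u v 1 2 s powr (- 1 / 3)) has_real_derivative
        (- 1 / 3) * wedge u v 1 2 s powr (- 1 / 3 - 1) * wedge u v 1 3 s) (at s)"
      using DERIV_fun_powr[OF dw(1)[OF that] bspec[OF pos that], of "- 1 / 3"] by simp
    also have "(- 1 / 3) * wedge u v 1 2 s powr (- 1 / 3 - 1) * wedge u v 1 3 s = q1 s"
      unfolding q1_def q_power[OF that] by simp
    finally show ?thesis
      by (simp add: q_def[abs_def])
  qed
  have dq1: "(q1 has_real_derivative q2 s) (at s)" if "s \<in> S" for s
    unfolding q1_def[abs_def] q2_def
    by (rule derivative_eq_intros dw dq that refl)+ (simp add: algebra_simps q1_def)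
  have sD_eq: "sD u v f s = d * q s"
    if "\<forall>r\<in>S. f r = g r" "(g has_real_derivative d) (at s)" "s \<in> S" for f g d s
  proof -
    have "(f has_real_derivative d) (at s)"
      by (rule has_field_derivative_transform_within_open[OF that(2) \<open>open S\<close> that(3)])
        (use that in auto)
    then show ?thesis
      by (simp add: sD_def speed that DERIV_imp_deriv)
  qed
  have sD_iter:
    "\<forall>s\<in>S. sD u v (sD u v f) s = ((deriv ^^ 2) f s * q s + deriv f s * q1 s) * q s"
    "\<forall>s\<in>S. sD u v (sD u v (sD u v f)) s =
      (((deriv ^^ 3) f s * q s + 2 * (deriv ^^ 2) f s * q1 s + deriv f s * q2 s) * q s
        + ((deriv ^^ 2) f s * q s + deriv f s * q1 s) * q1 s) * q s"
    if f: "smooth_on S f" for f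
  proof -
    have df: "(deriv f has_real_derivative (deriv ^^ 2) f s) (at s)"
        "((deriv ^^ 2) f has_real_derivative (deriv ^^ 3) f s) (at s)" if "s \<in> S" for s
      using smooth_on_has_derivative[OF f that, of 1] smooth_on_has_derivative[OF f that, of 2]
      by (simp_all add: numeral_eq_Suc)
    have 1: "\<forall>s\<in>S. sD u v f s = deriv f s * q s"
      by (simp add: sD_def speed)
    show 2: "\<forall>s\<in>S. sD u v (sD u v f) s = ((deriv ^^ 2) f s * q s + deriv f s * q1 s) * q s"
      by (auto intro!: sD_eq[OF 1] derivative_eq_intros df dq)
    have 3: "((\<lambda>s. ((deriv ^^ 2) f s * q s + deriv f s * q1 s) * q s) has_real_derivative
      ((deriv ^^ 3) f s * q s + 2 * (deriv ^^ 2) f s * q1 s + deriv f s * q2 s) * q s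
        + ((deriv ^^ 2) f s * q s + deriv f s * q1 s) * q1 s) (at s)" if "s \<in> S" for s
      by (rule derivative_eq_intros df dq dq1 that refl)+ (simp add: algebra_simps)
    show "\<forall>s\<in>S. sD u v (sD u v (sD u v f)) s =
      (((deriv ^^ 3) f s * q s + 2 * (deriv ^^ 2) f s * q1 s + deriv f s * q2 s) * q s
        + ((deriv ^^ 2) f s * q s + deriv f s * q1 s) * q1 s) * q s"
      using sD_eq[OF 2 3] by blast
  qed
  define D where "D i j = wedge u v i j t" for i j
  \<comment> \<open>By bilinearity only the brackets of the first three \<open>t\<close>-derivatives
    of the curve survive in the bracket of its second and third
    \<open>s\<close>-derivatives.\<close>
  have k: "eq_aff_curv u v t =
    q t ^ 5 * D 2 3 + q t ^ 4 * q1 t * D 1 3 + (2 * q t ^ 3 * q1 t ^ 2 - q t ^ 4 * q2 t) * D 1 2"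
  proof -
    note iter = sD_iter[OF u, THEN bspec, OF \<open>t \<in> S\<close>] sD_iter[OF v, THEN bspec, OF \<open>t \<in> S\<close>]
    have one: "(deriv ^^ 1) f = deriv f" for f :: "real \<Rightarrow> real" by simp
    show ?thesis
      unfolding eq_aff_curv_def Let_def wedge_def D_def iter one by algebra
  qed
  \<comment> \<open>This normalisation removes \<open>D 1 2\<close>; inserting \<open>q1\<close> and
    \<open>q2\<close> then collects the squares of \<open>D 1 3\<close> with coefficient
    \<open>- 1/3 + 2/9 - 4/9 = - 5/9\<close>.\<close>
  have "q t ^ 3 * D 1 2 = 1"
    using w12[OF \<open>t \<in> S\<close>] q_pos[OF \<open>t \<in> S\<close>] by (simp add: D_def)
  then have "eq_aff_curv u v t =
      q t ^ 5 * D 2 3 + q t ^ 4 * q1 t * D 1 3 + 2 * q1 t ^ 2 - q t * q2 t"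
    unfolding k by algebra
  also have "\<dots> = q t ^ 2 * (q t ^ 3 * (4 * D 2 3 + D 1 4) / 3 - 5 / 9 * (D 1 3 * q t ^ 3)\<^sup>2)"
    unfolding q2_def q1_def D_def[symmetric]
    by (simp add: algebra_simps eval_nat_numeral add_divide_distrib)
  finally have "eq_aff_curv u v t =
      q t ^ 2 * (q t ^ 3 * (4 * D 2 3 + D 1 4) / 3 - 5 / 9 * (D 1 3 * q t ^ 3)\<^sup>2)" .
  then have "eq_aff_curv u v t * (1 / q t)\<^sup>2 =
      wedge_lagr (wedge u v 1 2 t) (wedge u v 1 3 t) (wedge u v 1 4 t) (wedge u v 2 3 t)"
    using q_pos[OF \<open>t \<in> S\<close>]
    unfolding wedge_lagr_def D_def w12[OF \<open>t \<in> S\<close>] by (simp add: power_one_over mult_ac)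
  moreover have "full_aff_lagr u v t = sqrt (eq_aff_curv u v t * (1 / q t)\<^sup>2)"
    using q_pos[OF \<open>t \<in> S\<close>] by (simp add: full_aff_lagr_def speed[OF \<open>t \<in> S\<close>] real_sqrt_mult)
  ultimately show ?thesis by simp
qed

section \<open>The first variation\<close>

text \<open>A tube argument: \<open>f 0\<close> attains a positive minimum on the compact interval,
  and for small \<open>e\<close> the function moves by at most half of that minimum, uniformly in
  \<open>t\<close>.\<close>

lemma positive_on_neighbourhood_of_compact:
  fixes f :: "real \<Rightarrow> real \<Rightarrow> real"
  assumes cont: "continuous_on (UNIV \<times> {a..b}) (\<lambda>(e, t). f e t)"
    and pos: "\<forall>t\<in>{a..b}. f 0 t > 0"
  obtains d where "d > 0" "\<And>e t. \<bar>e\<bar> \<le> d \<Longrightarrow> t \<in> {a..b} \<Longrightarrow> f e t > 0"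
proof (cases "a \<le> b")
  case True
  have "continuous_on {a..b} (f 0)"
    using continuous_on_compose2[OF cont, of "{a..b}" "Pair 0"]
      continuous_on_Pair[OF continuous_on_const continuous_on_id, of "{a..b}" 0] by auto
  then obtain s where s: "s \<in> {a..b}" "\<forall>t\<in>{a..b}. f 0 s \<le> f 0 t"
    using continuous_attains_inf[of "{a..b}" "f 0"] True by auto
  obtain V where V: "0 \<in> V" "open V" "\<forall>e\<in>V \<inter> UNIV. \<forall>t\<in>{a..b}. dist (f e t) (f 0 t) \<le> f 0 s / 2"
    using continuous_on_prod_compactE[OF cont compact_Icc UNIV_I, of "f 0 s / 2" 0] pos s(1) by auto
  then obtain d where "d > 0" "cball 0 d \<subseteq> V"
    using open_contains_cball by blast
  show thesis
  proof (rule that[OF \<open>d > 0\<close>])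
    fix e t :: real assume "\<bar>e\<bar> \<le> d" "t \<in> {a..b}"
    then have "dist (f e t) (f 0 t) \<le> f 0 s / 2" "f 0 s \<le> f 0 t" "f 0 s > 0"
      using V \<open>cball 0 d \<subseteq> V\<close> s pos by auto
    then show "f e t > 0" unfolding dist_real_def abs_le_iff by linarith
  qed
qed (use that[of 1] in auto)

lemma funpow_deriv_0: "(deriv ^^ n) (\<lambda>t. 0) t = (0::real)"
  by (rule funpow_deriv_eq_on_open[of UNIV "\<lambda>n t. 0"]) auto

text \<open>All derivatives vanish on the open set \<open>I - {a..b}\<close>. Each endpoint is a
  limit of such points because \<open>I\<close> is open, so continuity carries the zero over. This
  kills the boundary terms later.\<close>

lemma funpow_deriv_vanishes_at_endpoints:
  assumes "open I" "smooth_on I f" "a \<le> b" "{a..b} \<subseteq> I" and zero: "\<forall>t\<in>I - {a..b}. f t = 0"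
  shows "(deriv ^^ n) f a = 0" "(deriv ^^ n) f b = 0"
proof -
  have "open (I - {a..b})"
    using \<open>open I\<close> by (simp add: open_Diff)
  then have off: "(deriv ^^ n) f t = 0" if "t \<in> I - {a..b}" for t
    using funpow_deriv_cong_on_open[of "I - {a..b}" f "\<lambda>t. 0"] zero that by (simp add: funpow_deriv_0)
  have "(deriv ^^ n) f c = 0" if c: "c \<in> I" and out: "\<And>e. e > 0 \<Longrightarrow> \<exists>t. dist c t < e \<and> t \<notin> {a..b}" for c
  proof (rule ccontr)
    assume "(deriv ^^ n) f c \<noteq> 0"
    moreover have "isCont ((deriv ^^ n) f) c"
      using smooth_on_has_derivative[OF assms(2) c] DERIV_isCont by blast
    ultimately obtain e where e: "e > 0" "\<forall>t. dist c t < e \<longrightarrow> (deriv ^^ n) f t \<noteq> 0"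
      using continuous_at_avoid by blast
    obtain r where r: "r > 0" "ball c r \<subseteq> I"
      using \<open>open I\<close> c openE by blast
    obtain t where "dist c t < min e r" "t \<notin> {a..b}"
      using out[of "min e r"] e r by auto
    with off[of t] e r show False by auto
  qed
  moreover have "\<exists>t. dist a t < e \<and> t \<notin> {a..b}" if "e > 0" for e :: real
    using that by (intro exI[of _ "a - e / 2"]) (simp add: dist_real_def)
  moreover have "\<exists>t. dist b t < e \<and> t \<notin> {a..b}" if "e > 0" for e :: real
    using that by (intro exI[of _ "b + e / 2"]) (simp add: dist_real_def)
  ultimately show "(deriv ^^ n) f a = 0" "(deriv ^^ n) f b = 0"
    using \<open>a \<le> b\<close> \<open>{a..b} \<subseteq> I\<close> by auto
qed

section \<open>Curves parametrised by equi-affine arc-length\<close>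

locale equi_affine_curve =
  fixes I :: "real set" and x y k :: "real \<Rightarrow> real"
  assumes open_I: "open I" and interval_I: "is_interval I"
    and smooth_x: "smooth_on I x" and smooth_y: "smooth_on I y"
    and unit_area: "\<forall>t\<in>I. deriv x t * (deriv ^^ 2) y t - deriv y t * (deriv ^^ 2) x t = 1"
    and curvature: "\<forall>t\<in>I. (deriv ^^ 3) x t = - k t * deriv x t \<and> (deriv ^^ 3) y t = - k t * deriv y t"
    and k_pos: "\<forall>t\<in>I. k t > 0"
begin

text \<open>The derivative of \<open>sqrt\<close> at \<open>k t\<close>: the weight with which a
  variation of the squared Lagrangian enters the variation of the length.\<close>

definition \<mu> :: "real \<Rightarrow> real" where
  "\<mu> t = 1 / 2 * k t powr (- 1 / 2)"

text \<open>The third derivative is \<open>- k\<close> times the first, which gives the brackets 13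
  and 23. Differentiating the vanishing bracket 13 shows that the brackets 23 and 14 add up to
  0.\<close>

lemma wedge_at_curve:
  assumes "t \<in> I"
  shows "wedge x y 1 2 t = 1" "wedge x y 1 3 t = 0" "wedge x y 2 3 t = k t" "wedge x y 1 4 t = - k t"
proof -
  show "wedge x y 1 2 t = 1"
    using unit_area assms by (simp add: wedge_def)
  have w13: "wedge x y 1 3 s = 0" if "s \<in> I" for s
    using curvature that by (simp add: wedge_def)
  show "wedge x y 1 3 t = 0" using w13 assms .
  have "wedge x y 2 3 t = k t * (deriv x t * (deriv ^^ 2) y t - deriv y t * (deriv ^^ 2) x t)"
    using bspec[OF curvature assms] by (simp add: wedge_def algebra_simps)
  then show w23: "wedge x y 2 3 t = k t"
    using bspec[OF unit_area assms] by simp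
  have "(wedge x y 1 3 has_real_derivative 0) (at t)"
    by (rule has_field_derivative_transform_within_open[OF DERIV_const[of 0] open_I assms]) (use w13 in simp)
  then have "wedge x y (Suc 1) 3 t + wedge x y 1 (Suc 3) t = 0"
    using wedge_has_derivative[OF smooth_x smooth_y assms] DERIV_unique by blast
  then show "wedge x y 1 4 t = - k t"
    using w23 by (simp add: numeral_eq_Suc)
qed

text \<open>Smoothness of \<open>k\<close> is not a hypothesis; it follows because \<open>k\<close>
  is a bracket of derivatives of the curve.\<close>

lemma smooth_k: "smooth_on I k"
proof (rule smooth_on_cong[OF open_I])
  show "smooth_on I (\<lambda>t. wedge x y 2 3 t)"
    unfolding wedge_def
    by (intro smooth_on_diff smooth_on_mult smooth_on_funpow_deriv open_I smooth_x smooth_y)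
qed (use wedge_at_curve in auto)

lemma smooth_\<mu>: "smooth_on I \<mu>"
  unfolding \<mu>_def[abs_def]
  by (intro smooth_on_mult smooth_on_const smooth_on_powr open_I smooth_k k_pos)

lemma \<mu>_sqrt: "t \<in> I \<Longrightarrow> \<mu> t = 1 / (2 * sqrt (k t))"
  using bspec[OF k_pos, of t] powr_minus_divide[of "k t" "1 / 2"] by (simp add: \<mu>_def powr_half_sqrt)

lemma deriv_\<mu>: "t \<in> I \<Longrightarrow> deriv \<mu> t = - 1 / 4 * k t powr (- 3 / 2) * deriv k t"
proof -
  assume t: "t \<in> I"
  have "(k has_real_derivative deriv k t) (at t)"
    using smooth_on_has_derivative[OF smooth_k t, of 0] by simp
  from DERIV_fun_powr[OF this bspec[OF k_pos t], of "- 1 / 2"]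
  have "((\<lambda>t. k t powr (- 1 / 2)) has_real_derivative (- 1 / 2) * k t powr (- 3 / 2) * deriv k t) (at t)"
    by simp
  from DERIV_imp_deriv[OF DERIV_cmult[OF this, of "1 / 2"]] show ?thesis
    by (simp add: \<mu>_def[abs_def])
qed

text \<open>The derivative of the relation \<open>4 * k * \<mu>^2 = 1\<close>, in the form that
  trades \<open>deriv k\<close> for \<open>deriv \<mu>\<close> during integration by parts.\<close>

lemma deriv_k_\<mu>: "t \<in> I \<Longrightarrow> deriv k t * \<mu> t = - 2 * k t * deriv \<mu> t"
proof -
  assume t: "t \<in> I"
  have "k t powr (- 3 / 2 + 1) = k t powr (- 3 / 2) * k t"
    unfolding powr_add using bspec[OF k_pos t] by simp
  then show ?thesis
    using t by (simp add: deriv_\<mu> \<mu>_def)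
qed

lemma full_aff_curv_eq: "t \<in> I \<Longrightarrow> full_aff_curv k t = - 2 * deriv \<mu> t"
  using powr_minus_divide[of "k t" "3 / 2"] by (simp add: full_aff_curv_def deriv_\<mu>)

lemma fourth_derivative:
  assumes "t \<in> I"
  shows "(deriv ^^ 4) x t = - deriv k t * deriv x t - k t * (deriv ^^ 2) x t"
    "(deriv ^^ 4) y t = - deriv k t * deriv y t - k t * (deriv ^^ 2) y t"
proof -
  have "(deriv ^^ 4) z t = - deriv k t * deriv z t - k t * (deriv ^^ 2) z t"
    if z: "smooth_on I z" and z3: "\<forall>t\<in>I. (deriv ^^ 3) z t = - k t * deriv z t" for z
  proof -
    have dk: "(k has_real_derivative deriv k t) (at t)"
      using smooth_on_has_derivative[OF smooth_k assms, of 0] by simp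
    have dz: "(deriv z has_real_derivative (deriv ^^ 2) z t) (at t)"
      using smooth_on_has_derivative[OF z assms, of 1] by (simp add: numeral_eq_Suc)
    have "((\<lambda>t. - k t * deriv z t) has_real_derivative
        - deriv k t * deriv z t - k t * (deriv ^^ 2) z t) (at t)"
      by (rule derivative_eq_intros dk dz refl)+ simp
    then have "((deriv ^^ 3) z has_real_derivative
        - deriv k t * deriv z t - k t * (deriv ^^ 2) z t) (at t)"
      by (rule has_field_derivative_transform_within_open[OF _ open_I assms]) (simp add: z3)
    moreover have "((deriv ^^ 3) z has_real_derivative (deriv ^^ 4) z t) (at t)"
      using smooth_on_has_derivative[OF z assms, of 3] by (simp add: numeral_eq_Suc)
    ultimately show ?thesis by (rule DERIV_unique[rotated])
  qed
  then show "(deriv ^^ 4) x t = - deriv k t * deriv x t - k t * (deriv ^^ 2) x t"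
    "(deriv ^^ 4) y t = - deriv k t * deriv y t - k t * (deriv ^^ 2) y t"
    using smooth_x smooth_y curvature by blast+
qed

section \<open>Differentiating the length along a variation\<close>

definition wedge_var :: "(real \<Rightarrow> real) \<Rightarrow> (real \<Rightarrow> real) \<Rightarrow> nat \<Rightarrow> nat \<Rightarrow> real \<Rightarrow> real" where
  "wedge_var X Y i j t = wedge x Y i j t + wedge X y i j t"

lemma continuous_on_wedge:
  "smooth_on I u \<Longrightarrow> smooth_on I v \<Longrightarrow> continuous_on I (wedge u v i j)"
  by (meson DERIV_isCont continuous_at_imp_continuous_on wedge_has_derivative)

text \<open>Bilinearity makes each bracket an exact quadratic polynomial in \<open>e\<close>, with
  \<open>wedge_var\<close> as its linear coefficient.\<close>

lemma wedge_perturbed: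
  assumes "smooth_on I X" "smooth_on I Y" "t \<in> I"
  shows "wedge (\<lambda>t. x t + e * X t) (\<lambda>t. y t + e * Y t) i j t =
    wedge x y i j t + e * wedge_var X Y i j t + e\<^sup>2 * wedge X Y i j t"
  unfolding wedge_var_def wedge_def
    funpow_deriv_add_scaled[OF open_I smooth_x assms(1,3)] funpow_deriv_add_scaled[OF open_I smooth_y assms(2,3)]
  by algebra

text \<open>Differentiation under the integral sign. At \<open>e = 0\<close> the squared Lagrangian
  is \<open>(4 * k - k) / 3 = k\<close>, and the variation of bracket 13 drops out because that
  bracket enters squared and vanishes on the curve.\<close>

lemma first_variation:
  assumes "smooth_on I X" "smooth_on I Y" and sub: "{a..b} \<subseteq> I"
  shows "((\<lambda>e. full_aff_length (\<lambda>t. x t + e * X t) (\<lambda>t. y t + e * Y t) a b) has_real_derivative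
    integral {a..b} (\<lambda>t. \<mu> t * ((4 * wedge_var X Y 2 3 t + wedge_var X Y 1 4 t) / 3 - k t * wedge_var X Y 1 2 t)))
    (at 0)"
proof -
  \<comment> \<open>\<open>w\<close> gives the brackets of the perturbed curve and \<open>F\<close>
    its squared Lagrangian; \<open>dw\<close> and \<open>dF\<close> are their derivatives in
    \<open>e\<close>, the latter by the quotient rule.\<close>
  define w where "w i j e t = wedge x y i j t + e * wedge_var X Y i j t + e\<^sup>2 * wedge X Y i j t" for i j e t
  define dw where "dw i j e t = wedge_var X Y i j t + 2 * e * wedge X Y i j t" for i j e t
  define F where "F e t = wedge_lagr (w 1 2 e t) (w 1 3 e t) (w 1 4 e t) (w 2 3 e t)" for e t
  define dF where "dF e t = (4 * dw 2 3 e t + dw 1 4 e t) / (3 * w 1 2 e t)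
    - (4 * w 2 3 e t + w 1 4 e t) * dw 1 2 e t / (3 * (w 1 2 e t)\<^sup>2)
    - 10 / 9 * (w 1 3 e t / w 1 2 e t) * ((dw 1 3 e t * w 1 2 e t - w 1 3 e t * dw 1 2 e t) / (w 1 2 e t)\<^sup>2)" for e t
  have cont_I: "continuous_on I (wedge x y i j)" "continuous_on I (wedge_var X Y i j)"
      "continuous_on I (wedge X Y i j)" for i j
    unfolding wedge_var_def[abs_def]
    by (intro continuous_intros continuous_on_wedge smooth_x smooth_y assms)+
  have cont_snd: "continuous_on A (\<lambda>p. f (snd p))"
    if "continuous_on I f" "A \<subseteq> UNIV \<times> {a..b}" for f :: "real \<Rightarrow> real" and A :: "(real \<times> real) set"
    using that sub by (intro continuous_on_compose2[OF that(1)] continuous_intros) auto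
  have cont_w: "continuous_on A (\<lambda>p. w i j (fst p) (snd p))"
      "continuous_on A (\<lambda>p. dw i j (fst p) (snd p))" if "A \<subseteq> UNIV \<times> {a..b}" for A i j
    unfolding w_def dw_def by (intro continuous_intros cont_snd cont_I that)+
  have w0: "w i j 0 t = wedge x y i j t" for i j t
    by (simp add: w_def)
  have F0: "F 0 t = k t" if "t \<in> I" for t
    using wedge_at_curve[OF that] by (simp add: F_def w0 wedge_lagr_def)
  obtain d1 where d1: "d1 > 0" "\<And>e t. \<bar>e\<bar> \<le> d1 \<Longrightarrow> t \<in> {a..b} \<Longrightarrow> w 1 2 e t > 0"
  proof (rule positive_on_neighbourhood_of_compact[of a b "w 1 2"])
    show "continuous_on (UNIV \<times> {a..b}) (\<lambda>(e, t). w 1 2 e t)"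
      unfolding split_beta by (rule cont_w) simp
    show "\<forall>t\<in>{a..b}. 0 < w 1 2 0 t"
      using sub wedge_at_curve(1) by (auto simp: w0)
  qed blast
  text \<open>Positivity of the Lagrangian is obtained after clearing denominators, because the tube
    argument needs a function that is continuous for all values of the parameter.\<close>
  obtain d2 where d2: "d2 > 0" "\<And>e t. \<bar>e\<bar> \<le> d2 \<Longrightarrow> t \<in> {a..b} \<Longrightarrow>
      3 * (4 * w 2 3 e t + w 1 4 e t) * w 1 2 e t - 5 * (w 1 3 e t)\<^sup>2 > 0"
  proof (rule positive_on_neighbourhood_of_compact
        [of a b "\<lambda>e t. 3 * (4 * w 2 3 e t + w 1 4 e t) * w 1 2 e t - 5 * (w 1 3 e t)\<^sup>2"])
    show "continuous_on (UNIV \<times> {a..b})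
        (\<lambda>(e, t). 3 * (4 * w 2 3 e t + w 1 4 e t) * w 1 2 e t - 5 * (w 1 3 e t)\<^sup>2)"
      unfolding split_beta by (intro continuous_intros cont_w) simp_all
    show "\<forall>t\<in>{a..b}. 0 < 3 * (4 * w 2 3 0 t + w 1 4 0 t) * w 1 2 0 t - 5 * (w 1 3 0 t)\<^sup>2"
      using sub wedge_at_curve k_pos unfolding w0 by (auto simp: subset_iff)
  qed blast
  define d where "d = min d1 d2"
  have "d > 0" using d1 d2 by (simp add: d_def)
  have w_pos: "w 1 2 e t > 0" if "e \<in> {-d..d}" "t \<in> {a..b}" for e t
    using that d1 by (auto simp: d_def)
  have F_pos: "F e t > 0" if "e \<in> {-d..d}" "t \<in> {a..b}" for e t
  proof -
    have "F e t = (3 * (4 * w 2 3 e t + w 1 4 e t) * w 1 2 e t - 5 * (w 1 3 e t)\<^sup>2) / (9 * (w 1 2 e t)\<^sup>2)"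
      using w_pos[OF that] unfolding F_def wedge_lagr_def by (simp add: field_simps power2_eq_square)
    moreover have "3 * (4 * w 2 3 e t + w 1 4 e t) * w 1 2 e t - 5 * (w 1 3 e t)\<^sup>2 > 0"
      using that d2 by (auto simp: d_def)
    ultimately show ?thesis
      using w_pos[OF that] by simp
  qed
  have lagr: "full_aff_lagr (\<lambda>t. x t + e * X t) (\<lambda>t. y t + e * Y t) t = sqrt (F e t)"
    if "e \<in> {-d..d}" "t \<in> {a..b}" for e t
  proof -
    \<comment> \<open>\<open>full_aff_lagr_eq\<close> needs an open set on which bracket 12 is
      positive, but positivity is only known on the closed interval; \<open>S\<close> is an open set
      containing it.\<close>
    define S where "S = w 1 2 e -` {0<..} \<inter> I"
    have "continuous_on I (w 1 2 e)"
      unfolding w_def[abs_def] by (intro continuous_intros cont_I)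
    then have "open S"
      using open_I unfolding S_def by (simp add: continuous_on_open_vimage)
    have w_eq: "wedge (\<lambda>t. x t + e * X t) (\<lambda>t. y t + e * Y t) i j s = w i j e s" if "s \<in> I" for i j s
      unfolding w_def using wedge_perturbed[OF assms(1,2) that] .
    have "smooth_on S (\<lambda>t. x t + e * X t)" "smooth_on S (\<lambda>t. y t + e * Y t)"
      by (rule smooth_on_subset[of I];
          force intro!: smooth_on_add smooth_on_mult smooth_on_const open_I smooth_x smooth_y assms
            simp: S_def)+
    then show ?thesis
      using full_aff_lagr_eq[OF \<open>open S\<close>, of "\<lambda>t. x t + e * X t" "\<lambda>t. y t + e * Y t" t]
        w_pos[OF that] that sub
      by (auto simp: w_eq S_def F_def)
  qed
  have dw: "((\<lambda>e. w i j e t) has_real_derivative dw i j e t) (at e within U)" for i j e t U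
    unfolding w_def dw_def by (auto intro!: derivative_eq_intros)
  have dF: "((\<lambda>e. F e t) has_real_derivative dF e t) (at e within U)"
    if "e \<in> {-d..d}" "t \<in> {a..b}" for e t U
  proof -
    have nz: "w 1 2 e t \<noteq> 0" "3 * w 1 2 e t \<noteq> 0"
      using w_pos[OF that] by simp_all
    show ?thesis
      unfolding F_def dF_def wedge_lagr_def
      by (rule derivative_eq_intros dw nz refl)+ (use nz in \<open>simp add: field_simps power2_eq_square\<close>)
  qed
  have "((\<lambda>e. integral (cbox a b) (\<lambda>t. sqrt (F e t))) has_field_derivative
      integral (cbox a b) (\<lambda>t. dF 0 t / (2 * sqrt (F 0 t)))) (at 0 within {-d..d})"
  proof (rule leibniz_rule_field_derivative)
    show "((\<lambda>e. sqrt (F e t)) has_real_derivative dF e t / (2 * sqrt (F e t))) (at e within {-d..d})"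
      if "e \<in> {-d..d}" "t \<in> cbox a b" for e t
      using DERIV_chain2[OF DERIV_real_sqrt dF, of e t] F_pos that
      by (auto simp: field_simps)
    have "continuous_on A (\<lambda>p. F (fst p) (snd p))" "continuous_on A (\<lambda>p. dF (fst p) (snd p))"
      if A: "A \<subseteq> {-d..d} \<times> {a..b}" for A
    proof -
      have A': "A \<subseteq> UNIV \<times> {a..b}" using A by auto
      have nz: "w 1 2 (fst p) (snd p) \<noteq> 0" if "p \<in> A" for p
        using w_pos[of "fst p" "snd p"] A that by force
      show "continuous_on A (\<lambda>p. F (fst p) (snd p))" "continuous_on A (\<lambda>p. dF (fst p) (snd p))"
        unfolding F_def dF_def wedge_lagr_def
        by (intro continuous_intros cont_w A' ballI; use nz in simp)+
    qed
    note cont_F = this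
    show "continuous_on ({-d..d} \<times> cbox a b) (\<lambda>(e, t). dF e t / (2 * sqrt (F e t)))"
      unfolding split_beta
    proof (intro continuous_intros cont_F ballI)
      fix p assume "p \<in> {-d..d} \<times> cbox a b"
      then show "2 * sqrt (F (fst p) (snd p)) \<noteq> 0"
        using F_pos[of "fst p" "snd p"] by force
    qed simp_all
    show "(\<lambda>t. sqrt (F e t)) integrable_on cbox a b" if "e \<in> {-d..d}" for e
    proof -
      have "continuous_on {a..b} (\<lambda>t. F e t)"
        using continuous_on_compose2[OF cont_F(1)[OF order_refl], of "{a..b}" "Pair e"]
          continuous_on_Pair[OF continuous_on_const continuous_on_id, of "{a..b}" e] that
        by (auto simp: image_subset_iff)
      then show ?thesis
        unfolding box_real by (intro integrable_continuous_real continuous_intros)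
    qed
    show "0 \<in> {-d..d}" "convex {-d..d}"
      using \<open>d > 0\<close> by simp_all
  qed
  moreover have "at 0 within {-d..d} = at 0"
    by (rule at_within_interior) (use \<open>d > 0\<close> in simp)
  ultimately have "((\<lambda>e. integral (cbox a b) (\<lambda>t. sqrt (F e t))) has_field_derivative
      integral (cbox a b) (\<lambda>t. dF 0 t / (2 * sqrt (F 0 t)))) (at 0)"
    by (simp only:)
  then have "((\<lambda>e. full_aff_length (\<lambda>t. x t + e * X t) (\<lambda>t. y t + e * Y t) a b) has_real_derivative
      integral (cbox a b) (\<lambda>t. dF 0 t / (2 * sqrt (F 0 t)))) (at 0)"
  proof (rule has_field_derivative_transform_within_open)
    fix e assume "e \<in> {-d<..<d}"
    then show "integral (cbox a b) (\<lambda>t. sqrt (F e t)) =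
        full_aff_length (\<lambda>t. x t + e * X t) (\<lambda>t. y t + e * Y t) a b"
      unfolding full_aff_length_def box_real
      by (intro integral_cong lagr[symmetric]) auto
  qed (use \<open>d > 0\<close> in auto)
  also have "integral (cbox a b) (\<lambda>t. dF 0 t / (2 * sqrt (F 0 t))) = integral {a..b}
      (\<lambda>t. \<mu> t * ((4 * wedge_var X Y 2 3 t + wedge_var X Y 1 4 t) / 3 - k t * wedge_var X Y 1 2 t))"
    unfolding box_real
  proof (rule integral_cong)
    fix t assume "t \<in> {a..b}"
    then have t: "t \<in> I" using sub by blast
    show "dF 0 t / (2 * sqrt (F 0 t)) =
        \<mu> t * ((4 * wedge_var X Y 2 3 t + wedge_var X Y 1 4 t) / 3 - k t * wedge_var X Y 1 2 t)"
      unfolding F0[OF t] \<mu>_sqrt[OF t] dF_def w0 wedge_at_curve[OF t] dw_def by simp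
  qed
  finally show ?thesis .
qed

section \<open>Integration by parts and the Euler--Lagrange equation\<close>

definition euler_lagrange :: "real \<Rightarrow> real" where
  "euler_lagrange t = (deriv ^^ 4) \<mu> t + k t * (deriv ^^ 2) \<mu> t"

lemma smooth_euler_lagrange: "smooth_on I euler_lagrange"
  unfolding euler_lagrange_def[abs_def]
  by (intro smooth_on_add smooth_on_mult smooth_on_funpow_deriv open_I smooth_k smooth_\<mu>)

text \<open>Three times the first integrand minus the second is the derivative of an expression that
  vanishes at both endpoints. Only the component of the variation transverse to the curve survives,
  in accordance with invariance under reparametrisation.\<close>

lemma first_variation_by_parts:
  assumes X: "smooth_on I X" and Y: "smooth_on I Y" and "a \<le> b" and sub: "{a..b} \<subseteq> I"
    and zero: "\<forall>t\<in>I - {a..b}. X t = 0 \<and> Y t = 0"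
  shows "integral {a..b} (\<lambda>t. \<mu> t * ((4 * wedge_var X Y 2 3 t + wedge_var X Y 1 4 t) / 3 - k t * wedge_var X Y 1 2 t))
    = integral {a..b} (\<lambda>t. euler_lagrange t * (deriv x t * Y t - deriv y t * X t)) / 3"
    (is "integral _ ?V = _")
proof -
  let ?E = "\<lambda>t. euler_lagrange t * (deriv x t * Y t - deriv y t * X t)"
  let ?D = "\<lambda>n f. (deriv ^^ n) f"
  text \<open>\<open>B\<close> collects the boundary terms of the repeated integrations by parts.\<close>
  define B where "B t = \<mu> t * (?D 1 x t * ?D 3 Y t - ?D 1 y t * ?D 3 X t)
    + 3 * \<mu> t * (?D 2 x t * ?D 2 Y t - ?D 2 y t * ?D 2 X t)
    - ?D 1 \<mu> t * (?D 1 x t * ?D 2 Y t - ?D 1 y t * ?D 2 X t)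
    + (?D 2 \<mu> t + 4 * \<mu> t * k t) * (?D 1 x t * ?D 1 Y t - ?D 1 y t * ?D 1 X t)
    - 2 * ?D 1 \<mu> t * (?D 2 x t * ?D 1 Y t - ?D 2 y t * ?D 1 X t)
    + ?D 2 \<mu> t * (?D 2 x t * Y t - ?D 2 y t * X t)
    - ?D 3 \<mu> t * (?D 1 x t * Y t - ?D 1 y t * X t)" for t
  have der: "(f has_real_derivative ?D 1 f t) (at t)" "(?D 1 f has_real_derivative ?D 2 f t) (at t)"
      "(?D 2 f has_real_derivative ?D 3 f t) (at t)" "(?D 3 f has_real_derivative ?D 4 f t) (at t)"
    if "smooth_on I f" "t \<in> I" for f t
    using smooth_on_has_derivative[OF that, of 0] smooth_on_has_derivative[OF that, of 1]
      smooth_on_has_derivative[OF that, of 2] smooth_on_has_derivative[OF that, of 3]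
    by (simp_all add: numeral_eq_Suc)
  have dB: "(B has_real_derivative 3 * ?V t - ?E t) (at t)" if t: "t \<in> I" for t
  proof -
    have one: "?D 1 f = deriv f" for f :: "real \<Rightarrow> real" by simp
    note c = bspec[OF curvature t]
    \<comment> \<open>\<open>deriv k\<close> enters only in products with \<open>\<mu>\<close>, so
      it can be eliminated. The two versions cover the two orders of factors that rewriting may
      meet.\<close>
    have k_\<mu>: "deriv k t * (p * (n * \<mu> t)) = - (2 * k t * deriv \<mu> t * (p * n))"
        "deriv k t * (p * (\<mu> t * n)) = - (2 * k t * deriv \<mu> t * (p * n))" for p n
      using deriv_k_\<mu>[OF t] by algebra+
    show ?thesis
      unfolding B_def[abs_def]
      by (rule derivative_eq_intros der[OF X t] der[OF Y t] der[OF smooth_x t] der[OF smooth_y t]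
          der[OF smooth_\<mu> t] der(1)[OF smooth_k t] refl)+
        (unfold wedge_var_def wedge_def euler_lagrange_def
          fourth_derivative[OF t] c[THEN conjunct1] c[THEN conjunct2] one, simp add: k_\<mu> field_simps)
  qed
  have "((\<lambda>t. 3 * ?V t - ?E t) has_integral B b - B a) {a..b}"
  proof (rule fundamental_theorem_of_calculus[OF \<open>a \<le> b\<close>])
    fix t assume "t \<in> {a..b}"
    then show "(B has_vector_derivative 3 * ?V t - ?E t) (at t within {a..b})"
      using dB sub has_real_derivative_iff_has_vector_derivative has_field_derivative_at_within by blast
  qed
  moreover have "B a = 0" "B b = 0"
  proof -
    have "?D n X a = 0" "?D n X b = 0" "?D n Y a = 0" "?D n Y b = 0" for n
      using zero funpow_deriv_vanishes_at_endpoints[OF open_I X \<open>a \<le> b\<close> sub]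
        funpow_deriv_vanishes_at_endpoints[OF open_I Y \<open>a \<le> b\<close> sub] by simp_all
    from this this(1-4)[of 0] this(1-4)[of 1] show "B a = 0" "B b = 0"
      unfolding B_def by simp_all
  qed
  moreover have "continuous_on {a..b} ?E"
    using smooth_on_continuous[OF smooth_euler_lagrange, of 0]
      smooth_on_continuous[OF smooth_x, of 1] smooth_on_continuous[OF smooth_y, of 1]
      smooth_on_continuous[OF X, of 0] smooth_on_continuous[OF Y, of 0]
    by (intro continuous_on_subset[OF _ sub] continuous_intros) simp_all
  then have "(?E has_integral integral {a..b} ?E) {a..b}"
    using integrable_continuous_real by blast
  \<comment> \<open>Adding \<open>?E\<close> back gives the integrability of \<open>?V\<close> and
    its integral at once.\<close>
  ultimately have "((\<lambda>t. (3 * ?V t - ?E t + ?E t) / 3) has_integral (0 - 0 + integral {a..b} ?E) / 3) {a..b}"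
    by (intro has_integral_divide has_integral_add) simp_all
  then show ?thesis
    by (simp add: integral_unique)
qed

text \<open>One direction is the fundamental lemma of the calculus of variations, localised at an
  arbitrary point by a bump; the other reads off the integrated first variation.\<close>

lemma critical_iff_euler_lagrange:
  "critical_full_affine I x y \<longleftrightarrow> (\<forall>t\<in>I. euler_lagrange t = 0)"
proof
  assume crit: "critical_full_affine I x y"
  show "\<forall>t\<in>I. euler_lagrange t = 0"
  proof
    fix t0 assume "t0 \<in> I"
    then obtain r where r: "r > 0" "cball t0 r \<subseteq> I"
      using open_I open_contains_cball by blast
    define a b where "a = t0 - r" and "b = t0 + r"
    have sub: "{a..b} \<subseteq> I" and "a < b" and t0: "t0 \<in> {a<..<b}"
      using r by (auto simp: a_def b_def cball_eq_atLeastAtMost)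
    obtain \<phi> where \<phi>: "smooth_on UNIV \<phi>" "\<And>t. t \<in> {a<..<b} \<Longrightarrow> \<phi> t > 0" "\<And>t. t \<notin> {a<..<b} \<Longrightarrow> \<phi> t = 0"
      using smooth_bump_exists[of a b] by blast
    text \<open>The test field \<open>E \<phi> \<gamma>''\<close> makes the first variation the integral of
      \<open>E\<^sup>2 \<phi>\<close>, since \<open>|\<gamma>',\<gamma>''| = 1\<close>.\<close>
    define X where "X t = euler_lagrange t * \<phi> t * (deriv ^^ 2) x t" for t
    define Y where "Y t = euler_lagrange t * \<phi> t * (deriv ^^ 2) y t" for t
    have X: "smooth_on I X" and Y: "smooth_on I Y"
      unfolding X_def[abs_def] Y_def[abs_def]
      using smooth_on_subset[OF \<phi>(1), of I]
      by (intro smooth_on_mult smooth_euler_lagrange smooth_on_funpow_deriv smooth_x smooth_y open_I; simp)+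
    have zero: "\<forall>t\<in>I - {a..b}. X t = 0 \<and> Y t = 0"
      using \<phi>(3) by (auto simp: X_def Y_def)
    have "integral {a..b} (\<lambda>t. euler_lagrange t * (deriv x t * Y t - deriv y t * X t)) = 0"
    proof -
      have "((\<lambda>\<epsilon>. full_aff_length (\<lambda>t. x t + \<epsilon> * X t) (\<lambda>t. y t + \<epsilon> * Y t) a b)
          has_real_derivative 0) (at 0)"
        using crit X Y sub zero unfolding critical_full_affine_def by blast
      from DERIV_unique[OF first_variation[OF X Y sub] this]
      show ?thesis
        unfolding first_variation_by_parts[OF X Y less_imp_le[OF \<open>a < b\<close>] sub zero] by simp
    qed
    moreover have "euler_lagrange t * (deriv x t * Y t - deriv y t * X t) = (euler_lagrange t)\<^sup>2 * \<phi> t"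
      if "t \<in> {a..b}" for t
    proof -
      have "deriv x t * (deriv ^^ 2) y t - deriv y t * (deriv ^^ 2) x t = 1"
        using unit_area sub that by blast
      then show ?thesis unfolding X_def Y_def by algebra
    qed
    ultimately have "integral {a..b} (\<lambda>t. (euler_lagrange t)\<^sup>2 * \<phi> t) = 0"
      by (metis (no_types, lifting) integral_cong)
    moreover have "continuous_on {a..b} (\<lambda>t. (euler_lagrange t)\<^sup>2 * \<phi> t)"
      using smooth_on_continuous[OF smooth_euler_lagrange, of 0]
        smooth_on_continuous[OF smooth_on_subset[OF \<phi>(1) subset_UNIV], of I 0]
      by (intro continuous_on_subset[OF _ sub] continuous_intros) simp_all
    moreover have "\<phi> t \<ge> 0" for t
      using \<phi>(2,3)[of t] by (cases "t \<in> {a<..<b}") auto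
    \<comment> \<open>A continuous nonnegative function with integral zero vanishes identically; at
      \<open>t0\<close> the bump is positive, so the other factor must be zero.\<close>
    ultimately have "\<forall>t\<in>{a..b}. (euler_lagrange t)\<^sup>2 * \<phi> t = 0"
      using integral_eq_0_iff[of a b "\<lambda>t. (euler_lagrange t)\<^sup>2 * \<phi> t"] \<open>a < b\<close> by simp
    then show "euler_lagrange t0 = 0"
      using t0 \<phi>(2)[OF t0] by force
  qed
next
  assume EL: "\<forall>t\<in>I. euler_lagrange t = 0"
  show "critical_full_affine I x y"
    unfolding critical_full_affine_def
  proof (intro allI impI)
    fix X Y a b
    assume X: "smooth_on I X" and Y: "smooth_on I Y" and sub: "{a..b} \<subseteq> I"
      and zero: "\<forall>t\<in>I - {a..b}. X t = 0 \<and> Y t = 0"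
    let ?V = "\<lambda>t. \<mu> t * ((4 * wedge_var X Y 2 3 t + wedge_var X Y 1 4 t) / 3 - k t * wedge_var X Y 1 2 t)"
    have "integral {a..b} ?V = 0"
    \<comment> \<open>\<open>critical_full_affine\<close> also admits \<open>a > b\<close>, where
      the interval is empty and the integral is 0.\<close>
    proof (cases "a \<le> b")
      case True
      have "integral {a..b} (\<lambda>t. euler_lagrange t * (deriv x t * Y t - deriv y t * X t)) = integral {a..b} (\<lambda>t. 0)"
        using EL sub by (intro integral_cong) auto
      then show ?thesis
        unfolding first_variation_by_parts[OF X Y True sub zero] by simp
    qed simp
    with first_variation[OF X Y sub]
    show "((\<lambda>\<epsilon>. full_aff_length (\<lambda>t. x t + \<epsilon> * X t) (\<lambda>t. y t + \<epsilon> * Y t) a b)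
        has_real_derivative 0) (at 0)"
      by simp
  qed
qed

text \<open>The connectedness of \<open>I\<close> enters here: a vanishing derivative gives one
  constant on the whole parameter domain.\<close>

lemma constant_on_I:
  assumes "\<And>t. t \<in> I \<Longrightarrow> (f has_real_derivative 0) (at t)"
  obtains c where "\<And>t. t \<in> I \<Longrightarrow> f t = c"
  using has_field_derivative_zero_constant[of I f] assms has_field_derivative_at_within
    is_interval_convex[OF interval_I] by blast

lemma curve_derivatives:
  assumes "t \<in> I"
  shows "(x has_real_derivative deriv x t) (at t)" "(y has_real_derivative deriv y t) (at t)"
    "(deriv x has_real_derivative (deriv ^^ 2) x t) (at t)"
    "(deriv y has_real_derivative (deriv ^^ 2) y t) (at t)"
    "((deriv ^^ 2) x has_real_derivative - k t * deriv x t) (at t)"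
    "((deriv ^^ 2) y has_real_derivative - k t * deriv y t) (at t)"
  using smooth_on_has_derivative[OF smooth_x assms, of 0] smooth_on_has_derivative[OF smooth_y assms, of 0]
    smooth_on_has_derivative[OF smooth_x assms, of 1] smooth_on_has_derivative[OF smooth_y assms, of 1]
    smooth_on_has_derivative[OF smooth_x assms, of 2] smooth_on_has_derivative[OF smooth_y assms, of 2]
    bspec[OF curvature assms]
  by (simp_all add: numeral_eq_Suc)

lemma \<mu>_derivatives:
  assumes "t \<in> I"
  shows "(deriv \<mu> has_real_derivative (deriv ^^ 2) \<mu> t) (at t)"
    "((deriv ^^ 2) \<mu> has_real_derivative (deriv ^^ 3) \<mu> t) (at t)"
    "((deriv ^^ 3) \<mu> has_real_derivative (deriv ^^ 4) \<mu> t) (at t)"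
  using smooth_on_has_derivative[OF smooth_\<mu> assms, of 1] smooth_on_has_derivative[OF smooth_\<mu> assms, of 2]
    smooth_on_has_derivative[OF smooth_\<mu> assms, of 3]
  by (simp_all add: numeral_eq_Suc)

section \<open>Solving the Euler--Lagrange equation\<close>

text \<open>If the Euler--Lagrange equation holds, then the vector \<open>\<mu>'' \<gamma>'' - \<mu>''' \<gamma>'\<close> is a first
  integral, and its wedge product with \<open>\<gamma>'\<close> is \<open>\<mu>''\<close>.\<close>

lemma euler_lagrange_iff_affine:
  "(\<forall>t\<in>I. euler_lagrange t = 0) \<longleftrightarrow> (\<exists>A B C. \<forall>t\<in>I. full_aff_curv k t = A * x t + B * y t + C)"
proof
  assume EL: "\<forall>t\<in>I. euler_lagrange t = 0"
  have EL4: "(deriv ^^ 4) \<mu> t = - k t * (deriv ^^ 2) \<mu> t" if "t \<in> I" for t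
    using bspec[OF EL that] by (simp add: euler_lagrange_def)
  have "((\<lambda>t. (deriv ^^ 2) \<mu> t * (deriv ^^ 2) x t - (deriv ^^ 3) \<mu> t * deriv x t) has_real_derivative 0) (at t)"
    if "t \<in> I" for t
    by (rule derivative_eq_intros curve_derivatives[OF that] \<mu>_derivatives[OF that] refl)+
      (simp add: EL4[OF that])
  from constant_on_I[OF this] obtain p where
    p: "\<And>t. t \<in> I \<Longrightarrow> (deriv ^^ 2) \<mu> t * (deriv ^^ 2) x t - (deriv ^^ 3) \<mu> t * deriv x t = p"
    by blast
  have "((\<lambda>t. (deriv ^^ 2) \<mu> t * (deriv ^^ 2) y t - (deriv ^^ 3) \<mu> t * deriv y t) has_real_derivative 0) (at t)"
    if "t \<in> I" for t
    by (rule derivative_eq_intros curve_derivatives[OF that] \<mu>_derivatives[OF that] refl)+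
      (simp add: EL4[OF that])
  from constant_on_I[OF this] obtain q where
    q: "\<And>t. t \<in> I \<Longrightarrow> (deriv ^^ 2) \<mu> t * (deriv ^^ 2) y t - (deriv ^^ 3) \<mu> t * deriv y t = q"
    by blast
  have "((\<lambda>t. deriv \<mu> t - (q * x t - p * y t)) has_real_derivative 0) (at t)" if "t \<in> I" for t
  proof -
    have "q * deriv x t - p * deriv y t =
        (deriv ^^ 2) \<mu> t * (deriv x t * (deriv ^^ 2) y t - deriv y t * (deriv ^^ 2) x t)"
      unfolding p[OF that, symmetric] q[OF that, symmetric] by (simp add: algebra_simps)
    then have "(deriv ^^ 2) \<mu> t = q * deriv x t - p * deriv y t"
      using bspec[OF unit_area that] by simp
    then show ?thesis
      by (auto intro!: derivative_eq_intros curve_derivatives[OF that] \<mu>_derivatives[OF that])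
  qed
  from constant_on_I[OF this] obtain c where
    c: "\<And>t. t \<in> I \<Longrightarrow> deriv \<mu> t - (q * x t - p * y t) = c"
    by blast
  have "full_aff_curv k t = (- 2 * q) * x t + (2 * p) * y t + (- 2 * c)" if "t \<in> I" for t
    using c[OF that] full_aff_curv_eq[OF that] by linarith
  then show "\<exists>A B C. \<forall>t\<in>I. full_aff_curv k t = A * x t + B * y t + C"
    by blast
next
  assume "\<exists>A B C. \<forall>t\<in>I. full_aff_curv k t = A * x t + B * y t + C"
  then obtain A B C where "\<forall>t\<in>I. full_aff_curv k t = A * x t + B * y t + C" by blast
  \<comment> \<open>Three differentiations of this affine relation remove \<open>C\<close> and reach
    third derivatives of the coordinates; the curvature equation turns these back into first ones,
    so the fourth derivative of \<open>\<mu>\<close> is \<open>- k\<close> times the second.\<close>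
  then have \<mu>1: "deriv \<mu> t = - (A * x t + B * y t + C) / 2" if "t \<in> I" for t
    using that full_aff_curv_eq[OF that] by simp
  have \<mu>2: "(deriv ^^ 2) \<mu> t = - (A * deriv x t + B * deriv y t) / 2" if "t \<in> I" for t
  proof (rule DERIV_unique[OF \<mu>_derivatives(1)[OF that]])
    have "((\<lambda>t. - (A * x t + B * y t + C) / 2) has_real_derivative - (A * deriv x t + B * deriv y t) / 2) (at t)"
      by (auto intro!: derivative_eq_intros curve_derivatives[OF that])
    then show "(deriv \<mu> has_real_derivative - (A * deriv x t + B * deriv y t) / 2) (at t)"
      by (rule has_field_derivative_transform_within_open[OF _ open_I that]) (simp add: \<mu>1)
  qed
  have \<mu>3: "(deriv ^^ 3) \<mu> t = - (A * (deriv ^^ 2) x t + B * (deriv ^^ 2) y t) / 2" if "t \<in> I" for t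
  proof (rule DERIV_unique[OF \<mu>_derivatives(2)[OF that]])
    have "((\<lambda>t. - (A * deriv x t + B * deriv y t) / 2) has_real_derivative
        - (A * (deriv ^^ 2) x t + B * (deriv ^^ 2) y t) / 2) (at t)"
      by (auto intro!: derivative_eq_intros curve_derivatives[OF that])
    then show "((deriv ^^ 2) \<mu> has_real_derivative - (A * (deriv ^^ 2) x t + B * (deriv ^^ 2) y t) / 2) (at t)"
      by (rule has_field_derivative_transform_within_open[OF _ open_I that]) (simp add: \<mu>2)
  qed
  have \<mu>4: "(deriv ^^ 4) \<mu> t = - (A * (- k t * deriv x t) + B * (- k t * deriv y t)) / 2" if "t \<in> I" for t
  proof (rule DERIV_unique[OF \<mu>_derivatives(3)[OF that]])
    have "((\<lambda>t. - (A * (deriv ^^ 2) x t + B * (deriv ^^ 2) y t) / 2) has_real_derivative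
        - (A * (- k t * deriv x t) + B * (- k t * deriv y t)) / 2) (at t)"
      by (auto intro!: derivative_eq_intros curve_derivatives[OF that])
    then show "((deriv ^^ 3) \<mu> has_real_derivative
        - (A * (- k t * deriv x t) + B * (- k t * deriv y t)) / 2) (at t)"
      by (rule has_field_derivative_transform_within_open[OF _ open_I that]) (simp add: \<mu>3)
  qed
  show "\<forall>t\<in>I. euler_lagrange t = 0"
    by (simp add: euler_lagrange_def \<mu>4 \<mu>2 field_simps)
qed

end

section \<open>Choice of the origin\<close>

lemma affine_function_normal_form:
  fixes f x y :: "'a \<Rightarrow> real"
  shows "(\<exists>A B C. \<forall>t\<in>I. f t = A * x t + B * y t + C) \<longleftrightarrow>
    ((\<exists>c. \<forall>t\<in>I. f t = c) \<or>
     (\<exists>x0 y0 A B. (A, B) \<noteq> (0, 0) \<and> (\<forall>t\<in>I. f t = A * (x t - x0) + B * (y t - y0))))"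
    (is "?L \<longleftrightarrow> ?R")
proof
  assume ?L
  then obtain A B C where f: "\<forall>t\<in>I. f t = A * x t + B * y t + C" by blast
  show ?R
  proof (cases "(A, B) = (0, 0)")
    case True
    with f show ?thesis by auto
  next
    case False
    \<comment> \<open>The new origin \<open>- (C / N) * (A, B)\<close> is the point on the line
      through 0 in direction \<open>(A, B)\<close> where the affine function vanishes.\<close>
    define N where "N = A\<^sup>2 + B\<^sup>2"
    have "N \<noteq> 0"
      using False by (simp add: N_def sum_power2_eq_zero_iff)
    then have "A * (A * C / N) + B * (B * C / N) = C"
      by (simp add: divide_simps) (simp add: N_def algebra_simps power2_eq_square)
    then have "\<forall>t\<in>I. f t = A * (x t - (- A * C / N)) + B * (y t - (- B * C / N))"
      using f by (simp add: algebra_simps)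
    with False show ?thesis by blast
  qed
next
  assume ?R
  then show ?L
  proof (elim disjE exE conjE)
    fix c assume "\<forall>t\<in>I. f t = c"
    then have "\<forall>t\<in>I. f t = 0 * x t + 0 * y t + c" by simp
    then show ?L by blast
  next
    fix x0 y0 A B assume "\<forall>t\<in>I. f t = A * (x t - x0) + B * (y t - y0)"
    then have "\<forall>t\<in>I. f t = A * x t + B * y t + (- A * x0 - B * y0)"
      by (simp add: algebra_simps)
    then show ?L by blast
  qed
qed

theorem theorem6:
  fixes I :: "real set" and x y k :: "real \<Rightarrow> real"
  assumes "open I" and "is_interval I" and "I \<noteq> {}"
    and "smooth_on I x" and "smooth_on I y"
    and "\<forall>t\<in>I. deriv x t * (deriv ^^ 2) y t - deriv y t * (deriv ^^ 2) x t = 1"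
    and "\<forall>t\<in>I. (deriv ^^ 3) x t = - k t * deriv x t \<and> (deriv ^^ 3) y t = - k t * deriv y t"
    and "\<forall>t\<in>I. k t > 0"
  shows "critical_full_affine I x y \<longleftrightarrow>
           ((\<exists>c. \<forall>t\<in>I. full_aff_curv k t = c) \<or>
            (\<exists>x0 y0 A B. (A, B) \<noteq> (0, 0) \<and>
               (\<forall>t\<in>I. full_aff_curv k t = A * (x t - x0) + B * (y t - y0))))"
proof -
  interpret equi_affine_curve I x y k
    using assms by unfold_locales
  show ?thesis
    unfolding critical_iff_euler_lagrange euler_lagrange_iff_affine
    by (rule affine_function_normal_form)
qed

end
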